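(* Let $H=\langle Y;\mathcal{R}\rangle$ be a finitely presented group generated by a set $Y\subset H$ of cardinality $k\ge 2$, with set of relations $\mathcal{R}$, let $F$ be the free group on $Y$, and let $\sigma$ be a permutation of $Y$. Let $\varphi_\sigma$ be the automorphism of $F$ induced by $\sigma$, and let $\rho:F\to H$ be the epimorphism induced by the identity map of $Y$. For each $y\in Y$ let $r_y,r'_y\in W_{\mathcal{R}}$, and put $$X_\sigma=\{\varphi_\sigma^{-1}(r_y\,y\,r'_y):\ y\in Y\}\subset F,\qquad G=\langle X_\sigma\rangle\le F .$$ Then the map $f_\sigma:G\to H$, $f_\sigma=(\rho\circ\varphi_\sigma)|_G$, is an epimorphism with $f_\sigma(\varphi_\sigma^{-1}(r_yyr'_y))=y$ for all $y\in Y$; in particular, its restriction $f$ to $X_\sigma$ is a bijection $f:X_\sigma\to Y$. Moreover, with the encryption $E$ and decryption $D$ defined in the context, $D(E(M))=M$ in $H$ for every message $M=y_{i_1}\cdots y_{i_t}\in H$ with $y_{i_j}\in Y^{\pm}$ and every choice of the words $s_j,s'_j\in W_{\mathcal{R}}$ used in the encryption.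
   Context: $W_Y$ denotes the set of all words in the alphabet $Y^{\pm}=Y\cup Y^{-1}$; $\mathcal{R}\subset W_Y$ is the set of relators of $H$, and $W_{\mathcal{R}}\subset W_Y$ is the set of all words in the alphabet $\mathcal{R}^{\pm}$, regarded as words in $Y^{\pm}$. Encryption: a message $M=y_{i_1}\cdots y_{i_t}\in H$, with $y_{i_j}\in Y^{\pm}$, is encrypted by $$E(M)=f^{-1}(s_1y_{i_1}s'_1)\cdots f^{-1}(s_ty_{i_t}s'_t)\in G,$$ where $s_j,s'_j\in W_{\mathcal{R}}$ are (randomly chosen) words and, for a word $w\in W_Y$, $f^{-1}(w)$ is obtained by replacing each letter $y\in Y$ of $w$ by $f^{-1}(y)$ (and each $y^{-1}$ by $f^{-1}(y)^{-1}$). Decryption: a ciphertext $C=y_{i_1}\cdots y_{i_t}\in G\subset F$, written with letters $y_{i_j}\in Y^{\pm}$, is decrypted to $D(C)=y_{i_1}^{\sigma}\cdots y_{i_t}^{\sigma}\in H$, where $y^\sigma$ is the image of $y\in Y$ under $\sigma$ and $(y^{-1})^\sigma=(y^\sigma)^{-1}$. *)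

theory Defs
  imports "HOL-Algebra.Elementary_Groups" "HOL-Combinatorics.Permutations"
begin

section \<open>Words and free groups\<close>

text \<open>A letter \<open>(y, True)\<close> stands for \<open>y\<close>, and \<open>(y, False)\<close> for the formal inverse of \<open>y\<close>.\<close>

type_synonym 'a word = "('a \<times> bool) list"

definition words :: "'a set \<Rightarrow> 'a word set" where
  "words Y = lists (Y \<times> UNIV)"

definition letter_inv :: "'a \<times> bool \<Rightarrow> 'a \<times> bool" where
  "letter_inv l = (fst l, \<not> snd l)"

definition word_inv :: "'a word \<Rightarrow> 'a word" where
  "word_inv w = rev (map letter_inv w)"

definition reduced :: "'a word \<Rightarrow> bool" where
  "reduced w \<longleftrightarrow> successively (\<lambda>a b. b \<noteq> letter_inv a) w"

fun add_letter :: "'a \<times> bool \<Rightarrow> 'a word \<Rightarrow> 'a word" where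
  "add_letter a [] = [a]"
| "add_letter a (b # w) = (if b = letter_inv a then w else a # b # w)"

definition free_reduce :: "'a word \<Rightarrow> 'a word" where
  "free_reduce w = foldr add_letter w []"

definition free_group :: "'a set \<Rightarrow> 'a word monoid" where
  "free_group Y =
     \<lparr>carrier = {w \<in> words Y. reduced w}, monoid.mult = (\<lambda>u v. free_reduce (u @ v)), monoid.one = []\<rparr>"

definition group_prod :: "('b, 'm) monoid_scheme \<Rightarrow> 'b list \<Rightarrow> 'b" where
  "group_prod K xs = foldr (\<otimes>\<^bsub>K\<^esub>) xs \<one>\<^bsub>K\<^esub>"

definition word_eval :: "('b, 'm) monoid_scheme \<Rightarrow> ('a \<Rightarrow> 'b) \<Rightarrow> 'a word \<Rightarrow> 'b" where
  "word_eval K g w =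
     group_prod K (map (\<lambda>(y, b). if b then g y else inv\<^bsub>K\<^esub> (g y)) w)"


section \<open>Presentations\<close>

text \<open>\<open>H = \<langle>Y; R\<rangle>\<close> for a subset \<open>Y\<close> of \<open>H\<close>: the homomorphism from the free group on \<open>Y\<close>
  to \<open>H\<close> extending the inclusion of \<open>Y\<close> is onto, and its kernel is the normal closure of \<open>R\<close>.
  The relators are arbitrary words, so they are reduced to become elements of the free group.\<close>

definition normal_closure :: "('b, 'm) monoid_scheme \<Rightarrow> 'b set \<Rightarrow> 'b set" where
  "normal_closure K S = \<Inter> {N. N \<lhd> K \<and> S \<subseteq> N}"

definition is_presentation :: "('a, 'm) monoid_scheme \<Rightarrow> 'a set \<Rightarrow> 'a word set \<Rightarrow> bool" where
  "is_presentation H Y R \<longleftrightarrow>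
     group H \<and> Y \<subseteq> carrier H \<and> R \<subseteq> words Y \<and> generate H Y = carrier H \<and>
     kernel (free_group Y) H (word_eval H id) = normal_closure (free_group Y) (free_reduce ` R)"

definition relator_words :: "'a word set \<Rightarrow> 'a word set" where
  "relator_words R = concat ` lists (R \<union> word_inv ` R)"


section \<open>Encryption and decryption\<close>

definition perm_aut :: "'a set \<Rightarrow> ('a \<Rightarrow> 'a) \<Rightarrow> 'a word \<Rightarrow> 'a word" where
  "perm_aut Y \<sigma> = word_eval (free_group Y) (\<lambda>y. [(\<sigma> y, True)])"

text \<open>\<open>G\<close> is the group of ciphertexts, \<open>finv\<close> the map sending \<open>y\<close> to \<open>f\<^sup>-\<^sup>1(y)\<close>, and \<open>m\<close> the message,
  whose \<open>j\<close>-th letter is padded by \<open>s j\<close> and \<open>s' j\<close>.\<close>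

definition encrypt ::
  "('b, 'm) monoid_scheme \<Rightarrow> ('a \<Rightarrow> 'b) \<Rightarrow> (nat \<Rightarrow> 'a word) \<Rightarrow> (nat \<Rightarrow> 'a word) \<Rightarrow> 'a word \<Rightarrow> 'b" where
  "encrypt G finv s s' m =
     group_prod G (map (\<lambda>j. word_eval G finv (s j @ [m ! j] @ s' j)) [0..<length m])"

definition decrypt :: "('a, 'm) monoid_scheme \<Rightarrow> ('a \<Rightarrow> 'a) \<Rightarrow> 'a word \<Rightarrow> 'a" where
  "decrypt H \<sigma> C = word_eval H \<sigma> C"


section \<open>Adequacy of the free group construction\<close>

text \<open>\<open>free_group Y\<close> is a group, every map from \<open>Y\<close> to a group extends uniquely to a
  homomorphism (\<open>word_eval_hom\<close>, \<open>word_eval_letter\<close>, \<open>hom_free_unique\<close>),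
  and a permutation of \<open>Y\<close> induces an automorphism (\<open>perm_aut_iso\<close>).\<close>

lemma letter_inv_inv [simp]: "letter_inv (letter_inv a) = a"
  by (simp add: letter_inv_def)
lemma letter_inv_neq [simp]: "letter_inv a \<noteq> a" "a \<noteq> letter_inv a"
  by (cases a; auto simp: letter_inv_def)+

lemma reduced_Nil [simp]: "reduced []" by (simp add: reduced_def)
lemma reduced_Cons: "reduced (a # w) \<longleftrightarrow> reduced w \<and> (w = [] \<or> hd w \<noteq> letter_inv a)"
  by (cases w) (auto simp: reduced_def)

lemma reduced_add_letter: "reduced w \<Longrightarrow> reduced (add_letter a w)"
  by (cases w) (auto simp: reduced_Cons)

lemma add_letter_inv: "reduced w \<Longrightarrow> add_letter a (add_letter (letter_inv a) w) = w"
  by (cases w rule: remdups_adj.cases) (auto simp: reduced_Cons)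

lemma reduced_foldr: "reduced x \<Longrightarrow> reduced (foldr add_letter u x)"
  by (induction u) (auto intro: reduced_add_letter)

lemma reduced_free_reduce [simp]: "reduced (free_reduce w)"
  by (simp add: free_reduce_def reduced_foldr)

lemma free_reduce_reduced: "reduced w \<Longrightarrow> free_reduce w = w"
proof (induction w)
  case (Cons a w)
  then show ?case by (cases w) (auto simp: free_reduce_def reduced_Cons)
qed (simp add: free_reduce_def)

lemma foldr_add_letter: "reduced x \<Longrightarrow> foldr add_letter (add_letter a u) x = add_letter a (foldr add_letter u x)"
  by (cases u) (auto simp: add_letter_inv reduced_foldr)

lemma foldr_free_reduce: "reduced x \<Longrightarrow> foldr add_letter (free_reduce u) x = foldr add_letter u x"
  by (induction u) (auto simp: free_reduce_def foldr_add_letter)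

lemma free_reduce_append: "free_reduce (u @ v) = foldr add_letter u (free_reduce v)"
  by (simp add: free_reduce_def)

lemma free_reduce_left [simp]: "free_reduce (free_reduce u @ v) = free_reduce (u @ v)"
  by (simp add: free_reduce_append foldr_free_reduce)
lemma free_reduce_right [simp]: "free_reduce (u @ free_reduce v) = free_reduce (u @ v)"
  by (simp add: free_reduce_append free_reduce_reduced)
lemma free_reduce_idem [simp]: "free_reduce (free_reduce u) = free_reduce u"
  by (simp add: free_reduce_reduced)

lemma words_append [simp]: "u @ v \<in> words Y \<longleftrightarrow> u \<in> words Y \<and> v \<in> words Y"
  by (auto simp: words_def)
lemma words_Nil [simp]: "[] \<in> words Y" by (simp add: words_def)
lemma words_Cons [simp]: "a # v \<in> words Y \<longleftrightarrow> fst a \<in> Y \<and> v \<in> words Y"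
  by (cases a) (auto simp: words_def)
lemma add_letter_words: "fst a \<in> Y \<Longrightarrow> w \<in> words Y \<Longrightarrow> add_letter a w \<in> words Y"
  by (cases w) auto
lemma free_reduce_words [simp]: "w \<in> words Y \<Longrightarrow> free_reduce w \<in> words Y"
  by (induction w) (auto simp: free_reduce_def add_letter_words)
lemma word_inv_words [simp]: "w \<in> words Y \<Longrightarrow> word_inv w \<in> words Y"
  by (induction w) (auto simp: word_inv_def letter_inv_def)

lemma free_group_simps [simp]:
  "w \<in> carrier (free_group Y) \<longleftrightarrow> w \<in> words Y \<and> reduced w"
  "u \<otimes>\<^bsub>free_group Y\<^esub> v = free_reduce (u @ v)"
  "\<one>\<^bsub>free_group Y\<^esub> = []"
  by (simp_all add: free_group_def)

lemma foldr_word_inv: "reduced x \<Longrightarrow> foldr add_letter (word_inv w) (foldr add_letter w x) = x"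
proof (induction w)
  case (Cons a w)
  then show ?case using add_letter_inv[of "foldr add_letter w x" "letter_inv a"]
    by (simp add: word_inv_def reduced_foldr)
qed (simp add: word_inv_def)

lemma group_free_group: "group (free_group Y)"
proof (rule groupI)
  fix w assume w: "w \<in> carrier (free_group Y)"
  have "free_reduce (word_inv w @ w) = []"
    using foldr_word_inv[of "[]" w] by (simp add: free_reduce_def)
  then have "free_reduce (free_reduce (word_inv w) @ w) = []" by simp
  then show "\<exists>y\<in>carrier (free_group Y). y \<otimes>\<^bsub>free_group Y\<^esub> w = \<one>\<^bsub>free_group Y\<^esub>"
    using w by (intro bexI[of _ "free_reduce (word_inv w)"]) auto
qed (auto simp: free_reduce_reduced)

lemma word_eval_Nil [simp]: "word_eval K g [] = \<one>\<^bsub>K\<^esub>"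
  by (simp add: word_eval_def group_prod_def)
lemma word_eval_Cons: "word_eval K g (a # w) =
   (if snd a then g (fst a) else inv\<^bsub>K\<^esub> (g (fst a))) \<otimes>\<^bsub>K\<^esub> word_eval K g w"
  by (simp add: word_eval_def group_prod_def split_beta)

context group begin
lemma word_eval_closed: "g ` Y \<subseteq> carrier G \<Longrightarrow> w \<in> words Y \<Longrightarrow> word_eval G g w \<in> carrier G"
  by (induction w) (auto simp: word_eval_Cons)
lemma word_eval_append: "g ` Y \<subseteq> carrier G \<Longrightarrow> u \<in> words Y \<Longrightarrow> v \<in> words Y \<Longrightarrow>
   word_eval G g (u @ v) = word_eval G g u \<otimes> word_eval G g v"
  by (induction u) (auto simp: word_eval_Cons word_eval_closed m_assoc image_subset_iff)
lemma word_eval_add_letter: "g ` Y \<subseteq> carrier G \<Longrightarrow> fst a \<in> Y \<Longrightarrow> v \<in> words Y \<Longrightarrow>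
   word_eval G g (add_letter a v) = word_eval G g (a # v)"
  by (cases v) (auto simp: word_eval_Cons word_eval_closed m_assoc[symmetric] image_subset_iff letter_inv_def)
lemma word_eval_free_reduce: "g ` Y \<subseteq> carrier G \<Longrightarrow> w \<in> words Y \<Longrightarrow>
   word_eval G g (free_reduce w) = word_eval G g w"
proof (induction w)
  case (Cons a w)
  have "word_eval G g (free_reduce (a # w)) = word_eval G g (add_letter a (free_reduce w))"
    by (simp add: free_reduce_def)
  also have "\<dots> = word_eval G g (a # w)"
    using Cons by (subst word_eval_add_letter) (auto simp: word_eval_Cons)
  finally show ?case .
qed (simp add: free_reduce_def)

lemma word_eval_hom: "g ` Y \<subseteq> carrier G \<Longrightarrow> word_eval G g \<in> hom (free_group Y) G"
  by (auto simp: hom_def word_eval_closed word_eval_free_reduce word_eval_append)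

lemma word_eval_letter: "g y \<in> carrier G \<Longrightarrow> word_eval G g [(y, True)] = g y"
  by (simp add: word_eval_Cons)
end

lemma inv_free_letter: "y \<in> Y \<Longrightarrow> inv\<^bsub>free_group Y\<^esub> [(y, True)] = [(y, False)]"
  by (rule group.inv_equality[OF group_free_group])
     (auto simp: free_reduce_def letter_inv_def reduced_def)

lemma hom_free_unique:
  assumes K: "group K" and h: "h \<in> hom (free_group Y) K" and w: "w \<in> carrier (free_group Y)"
  shows "h w = word_eval K (\<lambda>y. h [(y, True)]) w"
  using w
proof (induction w)
  case Nil
  then show ?case using hom_one[OF h group_free_group K] by simp
next
  case (Cons a w)
  obtain y b where a: "a = (y, b)" by fastforce
  have y: "y \<in> Y" and w: "w \<in> carrier (free_group Y)" and r: "reduced (a # w)"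
    using Cons.prems by (auto simp: a reduced_Cons)
  have l: "[a] \<in> carrier (free_group Y)" using y by (simp add: a reduced_Cons)
  have "a # w = [a] \<otimes>\<^bsub>free_group Y\<^esub> w" using r by (simp add: free_reduce_reduced)
  then have "h (a # w) = h [a] \<otimes>\<^bsub>K\<^esub> h w" using hom_mult[OF h l w] by simp
  moreover have "h [a] = (if b then h [(y,True)] else inv\<^bsub>K\<^esub> h [(y,True)])"
    using group_hom.hom_inv[of "free_group Y" K h "[(y,True)]"] y h K
    by (auto simp: a group_hom_def group_hom_axioms_def group_free_group inv_free_letter reduced_Cons)
  ultimately show ?case using Cons.IH[OF w] by (simp add: word_eval_Cons a)
qed

lemma perm_aut_iso:
  assumes s: "\<sigma> permutes Y"
  shows "perm_aut Y \<sigma> \<in> iso (free_group Y) (free_group Y)"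
proof -
  let ?F = "free_group Y"
  interpret F: group ?F by (rule group_free_group)
  have h: "perm_aut Y \<tau> \<in> hom ?F ?F" if "\<tau> permutes Y" for \<tau>
    unfolding perm_aut_def using that
    by (intro F.word_eval_hom) (auto simp: reduced_Cons permutes_in_image)
  have l: "perm_aut Y \<tau> [(y,True)] = [(\<tau> y,True)]" if "\<tau> permutes Y" "y \<in> Y" for \<tau> y
    unfolding perm_aut_def using that
    by (subst F.word_eval_letter) (auto simp: reduced_Cons permutes_in_image)
  have id: "word_eval ?F (\<lambda>y. [(y,True)]) w = w" if "w \<in> carrier ?F" for w
    using hom_free_unique[of ?F "\<lambda>w. w" Y w] that by (simp add: hom_def group_free_group)
  have c: "perm_aut Y \<tau> (perm_aut Y \<tau>' w) = w" 
    if "\<tau> permutes Y" "\<tau>' permutes Y" "\<And>y. \<tau> (\<tau>' y) = y" "w \<in> carrier ?F" for \<tau> \<tau>' w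
  proof -
    have "(perm_aut Y \<tau> \<circ> perm_aut Y \<tau>') w = word_eval ?F (\<lambda>y. (perm_aut Y \<tau> \<circ> perm_aut Y \<tau>') [(y,True)]) w"
      using that h by (intro hom_free_unique group_free_group Group.hom_compose) auto
    also have "\<dots> = word_eval ?F (\<lambda>y. [(y,True)]) w"
      unfolding word_eval_def using that
      by (intro arg_cong[where f="group_prod ?F"] map_cong refl)
         (auto simp: words_def l permutes_in_image)
    finally show ?thesis using id that by simp
  qed
  have s': "inv_into UNIV \<sigma> permutes Y" using s by (rule permutes_inv)
  have "bij_betw (perm_aut Y \<sigma>) (carrier ?F) (carrier ?F)"
    by (rule bij_betw_byWitness[where f'="perm_aut Y (inv_into UNIV \<sigma>)"])
       (use h[OF s] h[OF s'] c[OF s s'] c[OF s' s] permutes_inverses[OF s] in \<open>auto simp: hom_def Pi_def simp del: free_group_simps\<close>)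
  then show ?thesis using h s by (simp add: iso_def)
qed

end

theory Submission
  imports Defs
begin

text \<open>The point of the construction is that the composition \<open>\<rho> \<circ> \<phi>\<^sub>\<sigma>\<close> is itself an evaluation of
  words: it is the homomorphism from the free group to \<open>H\<close> that sends each letter \<open>y\<close> to \<open>\<sigma> y\<close>
  (\<open>eval_perm_aut\<close>), in other words it is the decryption. So deciphering a ciphertext means applying
  the epimorphism \<open>f\<^sub>\<sigma>\<close> to it, and it does not matter which word represents the ciphertext.

  Products of relators and their inverses are trivial in \<open>H\<close> (\<open>eval_relator_words\<close>), hence \<open>\<rho>\<close> maps
  a letter padded by such words to the letter itself (\<open>eval_padded\<close>). Applied to the generators
  \<open>\<phi>\<^sub>\<sigma>\<^sup>-\<^sup>1(r\<^sub>y y r'\<^sub>y)\<close> this says that \<open>f\<^sub>\<sigma>\<close> sends each of them to its \<open>y\<close>. Therefore \<open>f\<^sub>\<sigma>\<close> is injective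
  on the generators, and its image is a subgroup containing the generating set \<open>Y\<close> of \<open>H\<close>.

  Since homomorphisms commute with evaluation of words, and \<open>f\<^sub>\<sigma>\<close> undoes \<open>f\<^sup>-\<^sup>1\<close> on \<open>Y\<close>, the image
  under \<open>f\<^sub>\<sigma>\<close> of an encrypted message is the product in \<open>H\<close> of the padded letters of the message, and
  the padding disappears once more (\<open>hom_encrypt\<close>).\<close>

section \<open>Homomorphisms and evaluation of words\<close>

lemma word_eval_cong:
  assumes "w \<in> words Y" "\<And>y. y \<in> Y \<Longrightarrow> g y = g' y"
  shows "word_eval K g w = word_eval K g' w"
  using assms by (induction w) (auto simp: word_eval_Cons)

lemma group_prod_Nil [simp]: "group_prod K [] = \<one>\<^bsub>K\<^esub>"
  and group_prod_Cons [simp]: "group_prod K (a # xs) = a \<otimes>\<^bsub>K\<^esub> group_prod K xs"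
  by (simp_all add: group_prod_def)

lemma (in group) group_prod_closed: "set xs \<subseteq> carrier G \<Longrightarrow> group_prod G xs \<in> carrier G"
  by (induction xs) auto

lemma (in group_hom) hom_group_prod:
  "set xs \<subseteq> carrier G \<Longrightarrow> h (group_prod G xs) = group_prod H (map h xs)"
  by (induction xs) (auto simp: G.group_prod_closed)

lemma (in group_hom) hom_word_eval:
  assumes "g ` Y \<subseteq> carrier G" "w \<in> words Y"
  shows "h (word_eval G g w) = word_eval H (h \<circ> g) w"
  using assms(2)
proof (induction w)
  case (Cons a w)
  then have "g (fst a) \<in> carrier G" "word_eval G g w \<in> carrier G"
    using assms(1) by (auto simp: G.word_eval_closed)
  with Cons show ?case by (simp add: word_eval_Cons)
qed simp

lemma (in group) word_eval_word_inv:
  assumes "g ` Y \<subseteq> carrier G" "w \<in> words Y"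
  shows "word_eval G g (word_inv w) = inv (word_eval G g w)"
  using assms(2)
proof (induction w)
  case Nil
  show ?case by (simp add: word_inv_def)
next
  case (Cons a w)
  have a: "g (fst a) \<in> carrier G" and w: "w \<in> words Y" "word_eval G g w \<in> carrier G"
    using Cons.prems assms(1) by (auto simp: word_eval_closed)
  have "word_eval G g (word_inv (a # w)) = word_eval G g (word_inv w @ [letter_inv a])"
    by (simp add: word_inv_def)
  also have "\<dots> = word_eval G g (word_inv w) \<otimes> word_eval G g [letter_inv a]"
    using Cons.prems by (intro word_eval_append[OF assms(1)]) (simp_all add: letter_inv_def)
  also have "\<dots> = inv (word_eval G g (a # w))"
    using Cons.IH a w by (simp add: word_eval_Cons letter_inv_def inv_mult_group)
  finally show ?case .
qed

section \<open>Relators are trivial in the presented group\<close>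

lemma words_concat: "ws \<in> lists (words Y) \<Longrightarrow> concat ws \<in> words Y"
  by (induction ws) auto

lemma relator_words_subset: "R \<subseteq> words Y \<Longrightarrow> relator_words R \<subseteq> words Y"
  unfolding relator_words_def by (fastforce intro!: words_concat)

lemma subset_normal_closure: "S \<subseteq> normal_closure K S"
  by (auto simp: normal_closure_def)

text \<open>A reduced relator lies in the normal closure that a presentation equates with the kernel of
  the evaluation in \<open>H\<close>, and reduction does not change the value of a word.\<close>

lemma eval_relator_words:
  assumes "is_presentation H Y R" "w \<in> relator_words R"
  shows "word_eval H id w = \<one>\<^bsub>H\<^esub>"
proof -
  interpret group H using assms(1) by (simp add: is_presentation_def)
  have Y: "id ` Y \<subseteq> carrier H" and R: "R \<subseteq> words Y"
    using assms(1) by (auto simp: is_presentation_def)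
  have rel: "word_eval H id u = \<one>\<^bsub>H\<^esub>" if "u \<in> R" for u
  proof -
    have "free_reduce u \<in> kernel (free_group Y) H (word_eval H id)"
      using assms(1) subset_normal_closure[of "free_reduce ` R" "free_group Y"] that
      by (auto simp: is_presentation_def)
    then show ?thesis
      using word_eval_free_reduce[OF Y, of u] R that by (auto simp: kernel_def)
  qed
  have inv_rel: "word_eval H id u = \<one>\<^bsub>H\<^esub>" if "u \<in> R \<union> word_inv ` R" for u
    using that rel R by (auto simp: word_eval_word_inv[OF Y] subset_iff)
  have "word_eval H id (concat ws) = \<one>\<^bsub>H\<^esub>" if "ws \<in> lists (R \<union> word_inv ` R)" for ws
    using that
  proof (induction ws)
    case (Cons u ws)
    have "ws \<in> lists (words Y)"
      using Cons.hyps(2) R by (induction ws) auto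
    with Cons have "u \<in> words Y" "concat ws \<in> words Y"
      using R by (auto intro: words_concat)
    then have "word_eval H id (concat (u # ws))
        = word_eval H id u \<otimes>\<^bsub>H\<^esub> word_eval H id (concat ws)"
      using word_eval_append[OF Y] by simp
    then show ?case using Cons.IH inv_rel[OF Cons.hyps(1)] by (simp add: id_def)
  qed simp
  then show ?thesis using assms(2) by (auto simp: relator_words_def)
qed

lemma eval_padded:
  assumes pres: "is_presentation H Y R"
    and "u \<in> relator_words R" "v \<in> relator_words R" "fst l \<in> Y"
  shows "word_eval H id (u @ [l] @ v) = word_eval H id [l]"
proof -
  interpret group H using pres by (simp add: is_presentation_def)
  have Y: "id ` Y \<subseteq> carrier H" and R: "R \<subseteq> words Y"
    using pres by (auto simp: is_presentation_def)
  have w: "u \<in> words Y" "v \<in> words Y" "[l] \<in> words Y"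
    using assms relator_words_subset[OF R] by auto
  have "word_eval H id (u @ [l] @ v)
      = word_eval H id u \<otimes>\<^bsub>H\<^esub> (word_eval H id [l] \<otimes>\<^bsub>H\<^esub> word_eval H id v)"
    using w by (simp only: word_eval_append[OF Y] words_append simp_thms)
  then show ?thesis
    using assms w word_eval_closed[OF Y, of "[l]"] by (simp add: eval_relator_words[OF pres])
qed

section \<open>Decryption as a homomorphism\<close>

text \<open>Decryption is a letterwise substitution and, read this way, a homomorphism composed of two
  others. This turns every claim about decrypted words into one about \<open>f\<^sub>\<sigma>\<close>.\<close>

lemma eval_perm_aut:
  assumes "group H" "Y \<subseteq> carrier H" "\<sigma> permutes Y" "w \<in> words Y"
  shows "word_eval H id (perm_aut Y \<sigma> w) = decrypt H \<sigma> w"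
proof -
  interpret group H by fact
  interpret \<rho>: group_hom "free_group Y" H "word_eval H id"
    using assms word_eval_hom[of id Y]
    by (simp add: group_hom_def group_hom_axioms_def group_free_group)
  have \<sigma>: "\<sigma> y \<in> Y" if "y \<in> Y" for y
    using assms(3) that by (simp add: permutes_in_image)
  have "word_eval H id (perm_aut Y \<sigma> w)
      = word_eval H (word_eval H id \<circ> (\<lambda>y. [(\<sigma> y, True)])) w"
    unfolding perm_aut_def
    by (rule \<rho>.hom_word_eval[OF _ assms(4)]) (auto simp: reduced_Cons \<sigma>)
  also have "\<dots> = decrypt H \<sigma> w"
    unfolding decrypt_def
    by (rule word_eval_cong[OF assms(4)]) (use \<sigma> assms(2) in \<open>auto intro!: word_eval_letter[of id, simplified]\<close>)
  finally show ?thesis .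
qed

lemma padded_words_in_words:
  assumes "R \<subseteq> words Y" "m \<in> words Y" "j < length m" "u \<in> relator_words R" "v \<in> relator_words R"
  shows "u @ [m ! j] @ v \<in> words Y"
proof -
  have "m ! j \<in> set m" using assms(3) by simp
  then have "fst (m ! j) \<in> Y" using assms(2) by (auto simp: words_def in_lists_conv_set)
  then show ?thesis using assms relator_words_subset[OF assms(1)] by auto
qed

lemma (in group) encrypt_closed:
  assumes "R \<subseteq> words Y" "m \<in> words Y" "g ` Y \<subseteq> carrier G"
    and "\<And>j. j < length m \<Longrightarrow> s j \<in> relator_words R \<and> s' j \<in> relator_words R"
  shows "encrypt G g s s' m \<in> carrier G"
  unfolding encrypt_def
  using assms(4)
  by (intro group_prod_closed)
     (auto intro!: word_eval_closed[OF assms(3)] padded_words_in_words[OF assms(1,2)]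
        simp del: append_Cons append.simps)

text \<open>Any section \<open>g\<close> over \<open>Y\<close> of a homomorphism to \<open>H\<close> serves for encryption: pushing the ciphertext
  forward replaces \<open>g\<close> by the inclusion of \<open>Y\<close>, and then every block collapses to its middle letter.\<close>

lemma (in group_hom) hom_encrypt:
  assumes pres: "is_presentation H Y R" and m: "m \<in> words Y"
    and g: "g ` Y \<subseteq> carrier G" "\<And>y. y \<in> Y \<Longrightarrow> h (g y) = y"
    and s: "\<And>j. j < length m \<Longrightarrow> s j \<in> relator_words R \<and> s' j \<in> relator_words R"
  shows "h (encrypt G g s s' m) = word_eval H id m"
proof -
  have R: "R \<subseteq> words Y" using pres by (simp add: is_presentation_def)
  have w: "s j @ [m ! j] @ s' j \<in> words Y" if "j < length m" for j
    using padded_words_in_words[OF R m] s that by blast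
  have block: "h (word_eval G g (s j @ [m ! j] @ s' j)) = word_eval H id [m ! j]"
    if j: "j < length m" for j
  proof -
    have "h (word_eval G g (s j @ [m ! j] @ s' j)) = word_eval H (h \<circ> g) (s j @ [m ! j] @ s' j)"
      by (rule hom_word_eval[OF g(1) w[OF j]])
    also have "\<dots> = word_eval H id (s j @ [m ! j] @ s' j)"
      by (rule word_eval_cong[OF w[OF j]]) (simp add: g(2))
    also have "\<dots> = word_eval H id [m ! j]"
      using s[OF j] w[OF j] by (intro eval_padded[OF pres]) auto
    finally show ?thesis .
  qed
  have "h (encrypt G g s s' m)
      = group_prod H (map (\<lambda>j. h (word_eval G g (s j @ [m ! j] @ s' j))) [0..<length m])"
    unfolding encrypt_def
    by (subst hom_group_prod)
       (use w in \<open>auto simp: o_def simp del: append_Cons append.simps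
          intro!: G.word_eval_closed[OF g(1)]\<close>)
  also have "\<dots> = group_prod H (map (\<lambda>j. word_eval H id [m ! j]) [0..<length m])"
    by (intro arg_cong[where f="group_prod H"] map_cong refl)
       (simp add: block del: append_Cons append.simps)
  also have "map (\<lambda>j. word_eval H id [m ! j]) [0..<length m] = map (\<lambda>l. word_eval H id [l]) m"
    by (rule nth_equalityI) auto
  also have "group_prod H (map (\<lambda>l. word_eval H id [l]) m) = word_eval H id m"
  proof -
    have "l \<in> Y \<times> UNIV" if "l \<in> set m" for l
      using m that by (auto simp: words_def in_lists_conv_set)
    then have "map (\<lambda>l. word_eval H id [l]) m = map (\<lambda>(y, b). if b then id y else inv\<^bsub>H\<^esub> (id y)) m"
      using pres by (intro map_cong refl) (force simp: word_eval_Cons is_presentation_def)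
    then show ?thesis unfolding word_eval_def[of H id m] by (rule arg_cong)
  qed
  finally show ?thesis .
qed

section \<open>Correctness of the cryptosystem\<close>

theorem mainTheorem3:
  fixes H :: "('a, 'm) monoid_scheme" and Y :: "'a set" and R :: "'a word set"
    and k :: nat and \<sigma> :: "'a \<Rightarrow> 'a" and r r' :: "'a \<Rightarrow> 'a word"
  assumes presentation: "is_presentation H Y R"
    and finite_Y: "finite Y" and card_Y: "card Y = k" and k_ge_2: "k \<ge> 2"
    and finite_R: "finite R"
    and perm: "\<sigma> permutes Y"
    and r: "\<And>y. y \<in> Y \<Longrightarrow> r y \<in> relator_words R"
    and r': "\<And>y. y \<in> Y \<Longrightarrow> r' y \<in> relator_words R"
  defines "F \<equiv> free_group Y"
    and "\<phi> \<equiv> perm_aut Y \<sigma>"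
    and "\<rho> \<equiv> word_eval H id"
  defines "x \<equiv> \<lambda>y. inv_into (carrier F) \<phi> (free_reduce (r y @ [(y, True)] @ r' y))"
  defines "X\<^sub>\<sigma> \<equiv> x ` Y"
  defines "G \<equiv> subgroup_generated F X\<^sub>\<sigma>"
  defines "f\<^sub>\<sigma> \<equiv> restrict (\<rho> \<circ> \<phi>) (carrier G)"
  defines "f \<equiv> restrict f\<^sub>\<sigma> X\<^sub>\<sigma>"
  shows "f\<^sub>\<sigma> \<in> epi G H
    \<and> (\<forall>y\<in>Y. f\<^sub>\<sigma> (x y) = y)
    \<and> bij_betw f X\<^sub>\<sigma> Y
    \<and> (\<forall>m\<in>words Y. \<forall>s s'.
          (\<forall>j<length m. s j \<in> relator_words R \<and> s' j \<in> relator_words R) \<longrightarrow>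
          (let C = encrypt G (inv_into X\<^sub>\<sigma> f) s s' m in
             C \<in> carrier G \<and>
             decrypt H \<sigma> C = word_eval H id m \<and>
             (\<forall>w\<in>words Y. free_reduce w = C \<longrightarrow> decrypt H \<sigma> w = word_eval H id m)))"
proof -
  interpret H: group H using presentation by (simp add: is_presentation_def)
  interpret F: group F unfolding F_def by (rule group_free_group)
  have Y: "Y \<subseteq> carrier H" and R: "R \<subseteq> words Y" and gen: "generate H Y = carrier H"
    using presentation by (auto simp: is_presentation_def)
  have carrier_F: "w \<in> carrier F \<longleftrightarrow> w \<in> words Y \<and> reduced w" for w
    by (simp add: F_def)
  have bij: "bij_betw \<phi> (carrier F) (carrier F)"
    using perm_aut_iso[OF perm] by (simp add: iso_def F_def \<phi>_def)
  have decrypt_eq: "\<rho> (\<phi> w) = decrypt H \<sigma> w" if "w \<in> words Y" for w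
    using eval_perm_aut[OF H.is_group Y perm that] by (simp add: \<rho>_def \<phi>_def)
  have padded: "free_reduce (r y @ [(y, True)] @ r' y) \<in> carrier F"
      "word_eval H id (free_reduce (r y @ [(y, True)] @ r' y)) = y" if y: "y \<in> Y" for y
  proof -
    have w: "r y @ [(y, True)] @ r' y \<in> words Y"
      using r[OF y] r'[OF y] y relator_words_subset[OF R] by auto
    then show "free_reduce (r y @ [(y, True)] @ r' y) \<in> carrier F"
      unfolding carrier_F using free_reduce_words reduced_free_reduce by blast
    have "word_eval H id (free_reduce (r y @ [(y, True)] @ r' y))
        = word_eval H id (r y @ [(y, True)] @ r' y)"
      using Y by (intro H.word_eval_free_reduce[OF _ w]) auto
    also have "\<dots> = word_eval H id [(y, True)]"
      using y by (intro eval_padded[OF presentation r[OF y] r'[OF y]]) simp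
    also have "\<dots> = y" using Y y by (subst H.word_eval_letter) auto
    finally show "word_eval H id (free_reduce (r y @ [(y, True)] @ r' y)) = y" .
  qed
  have x_F: "x y \<in> carrier F" and \<phi>_x: "\<phi> (x y) = free_reduce (r y @ [(y, True)] @ r' y)"
    if "y \<in> Y" for y
    using padded(1)[OF that] bij unfolding x_def bij_betw_def
    by (metis inv_into_into, metis f_inv_into_f)
  have X_F: "X\<^sub>\<sigma> \<subseteq> carrier F" using x_F by (auto simp: X\<^sub>\<sigma>_def)
  have X_G: "X\<^sub>\<sigma> \<subseteq> carrier G"
    using X_F unfolding G_def by (rule F.subgroup_generated_subset_carrier_subset)
  have G_F: "carrier G \<subseteq> carrier F"
    unfolding G_def by (rule F.carrier_subgroup_generated_subset)
  interpret G: group G unfolding G_def by simp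
  have f_decrypt: "f\<^sub>\<sigma> w = decrypt H \<sigma> w" if "w \<in> carrier G" for w
    using that G_F decrypt_eq carrier_F by (auto simp: f\<^sub>\<sigma>_def)
  have hom_F: "decrypt H \<sigma> \<in> hom F H"
    unfolding F_def decrypt_def[abs_def] using Y perm
    by (intro H.word_eval_hom) (auto simp: permutes_in_image)
  have "f\<^sub>\<sigma> \<in> hom G H"
  proof (rule homI)
    fix u v assume u: "u \<in> carrier G" and v: "v \<in> carrier G"
    show "f\<^sub>\<sigma> u \<in> carrier H"
      using hom_in_carrier[OF hom_F] G_F u by (auto simp: f_decrypt)
    have "f\<^sub>\<sigma> (u \<otimes>\<^bsub>G\<^esub> v) = decrypt H \<sigma> (u \<otimes>\<^bsub>F\<^esub> v)"
      using f_decrypt[OF G.m_closed[OF u v]] by (simp add: G_def)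
    then show "f\<^sub>\<sigma> (u \<otimes>\<^bsub>G\<^esub> v) = f\<^sub>\<sigma> u \<otimes>\<^bsub>H\<^esub> f\<^sub>\<sigma> v"
      using hom_mult[OF hom_F] G_F u v by (auto simp: f_decrypt)
  qed
  then interpret f: group_hom G H "f\<^sub>\<sigma>" 
    by unfold_locales
  have f_x: "f\<^sub>\<sigma> (x y) = y" if y: "y \<in> Y" for y
    using X_G y padded(2)[OF y] by (auto simp: f\<^sub>\<sigma>_def \<phi>_x \<rho>_def X\<^sub>\<sigma>_def
        simp del: append_Cons append.simps)
  have "Y \<subseteq> f\<^sub>\<sigma> ` carrier G"
    using X_G f_x by (force simp: X\<^sub>\<sigma>_def)
  then have "carrier H \<subseteq> f\<^sub>\<sigma> ` carrier G"
    using H.generate_subgroup_incl[OF _ f.img_is_subgroup] gen by metis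
  then have epi: "f\<^sub>\<sigma> \<in> epi G H"
    using f.homh by (auto simp: epi_def)
  have bij_f: "bij_betw f X\<^sub>\<sigma> Y"
    by (rule bij_betw_byWitness[where f' = x]) (auto simp: f_def X\<^sub>\<sigma>_def f_x)
  have finv: "inv_into X\<^sub>\<sigma> f y \<in> X\<^sub>\<sigma>" "f\<^sub>\<sigma> (inv_into X\<^sub>\<sigma> f y) = y" if "y \<in> Y" for y
  proof -
    show X: "inv_into X\<^sub>\<sigma> f y \<in> X\<^sub>\<sigma>"
      using bij_f that by (metis bij_betw_def inv_into_into)
    then show "f\<^sub>\<sigma> (inv_into X\<^sub>\<sigma> f y) = y"
      using bij_betw_inv_into_right[OF bij_f that] by (simp add: f_def)
  qed
  have correct: "encrypt G (inv_into X\<^sub>\<sigma> f) s s' m \<in> carrier G"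
      "decrypt H \<sigma> (encrypt G (inv_into X\<^sub>\<sigma> f) s s' m) = word_eval H id m"
    if m: "m \<in> words Y" and s: "\<forall>j<length m. s j \<in> relator_words R \<and> s' j \<in> relator_words R"
    for m s s'
  proof -
    have g: "inv_into X\<^sub>\<sigma> f ` Y \<subseteq> carrier G" using finv X_G by auto
    show C: "encrypt G (inv_into X\<^sub>\<sigma> f) s s' m \<in> carrier G"
      using s by (intro G.encrypt_closed[OF R m g]) auto
    have "f\<^sub>\<sigma> (encrypt G (inv_into X\<^sub>\<sigma> f) s s' m) = word_eval H id m"
      using s by (intro f.hom_encrypt[OF presentation m g finv(2)]) auto
    then show "decrypt H \<sigma> (encrypt G (inv_into X\<^sub>\<sigma> f) s s' m) = word_eval H id m"
      using f_decrypt[OF C] by simp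
  qed
  have decrypt_reduce: "decrypt H \<sigma> (free_reduce w) = decrypt H \<sigma> w" if "w \<in> words Y" for w
    unfolding decrypt_def using Y perm that
    by (intro H.word_eval_free_reduce) (auto simp: permutes_in_image)
  show ?thesis
    unfolding Let_def using epi f_x bij_f correct decrypt_reduce by metis
qed

end
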